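(* Let $L^{(1)}=W_o^{(1)}\in\mathbb{R}^{n\times n}$ and $L^{(2)}=W_o^{(2)}\in\mathbb{R}^{n\times n}$ be the finite-horizon observability Gramians of two discrete-time linear systems with $n$ states, and let $\mathcal{Y}=\{1,\dots,n\}$. If $W_o^{(1)}\preceq W_o^{(2)}$, then for every $S\subseteq\mathcal{Y}$ the inclusion probability under the more observable system is at least as large, that is, $$\mathbb{P}_{L^{(1)}}(S\subseteq Y)\le\mathbb{P}_{L^{(2)}}(S\subseteq Y)\qquad\text{for all }S\subseteq\mathcal{Y},$$ where $\mathbb{P}_{L^{(i)}}(S\subseteq Y)=\det(K^{(i)}_S)$ is the probability that $S$ is included in a random subset $Y$ drawn from the determinantal point process with kernel $L^{(i)}$.
   Context: For $x[k+1]=Ax[k]+Bu[k]$, $y[k]=Cx[k]$, the observability Gramian over horizon $N$ is $W_o=\sum_{k=0}^{N-1}(A^k)^\top C^\top CA^k\in\mathbb{R}^{n\times n}$, which is symmetric positive semidefinite; $W_o^{(i)}$ is the Gramian of system $(A^{(i)},C^{(i)})$. For a matrix $M$ and an index set $S$, $M_S=[M_{ij}]_{i,j\in S}$ is the principal submatrix, with $\det(M_\emptyset)=1$. For symmetric $L\succeq0$ indexed by $\mathcal{Y}$, the L-ensemble determinantal point process (DPP) with kernel $L$ is the probability measure $\mathcal{P}_L(Y)=\det(L_Y)/\det(L+I)$ on $2^{\mathcal{Y}}$; its marginal kernel is $K=L(L+I)^{-1}$, and $K^{(i)}=L^{(i)}(L^{(i)}+I)^{-1}$. $\preceq$ is the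 positive semidefinite (Loewner) order. *)

theory Defs
  imports "HOL-Analysis.Analysis"
begin

(* The square-matrix type is an instance of power only through the componentwise product,
   so matrix powers have to be iterated products with **. *)
definition matrix_pow :: "real^'n^'n \<Rightarrow> nat \<Rightarrow> real^'n^'n" where
  "matrix_pow A k = (((**) A) ^^ k) (mat 1)"

definition observability_gramian :: "nat \<Rightarrow> real^'n^'n \<Rightarrow> real^'n^'p \<Rightarrow> real^'n^'n" where
  "observability_gramian N A C =
     (\<Sum>k<N. transpose (matrix_pow A k) ** transpose C ** C ** matrix_pow A k)"

definition psd_matrix :: "real^'n^'n \<Rightarrow> bool" where
  "psd_matrix M \<longleftrightarrow> transpose M = M \<and> (\<forall>x. 0 \<le> x \<bullet> (M *v x))"

definition loewner_le :: "real^'n^'n \<Rightarrow> real^'n^'n \<Rightarrow> bool" (infix "\<preceq>\<^sub>L" 50) where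
  "M \<preceq>\<^sub>L M' \<longleftrightarrow> psd_matrix (M' - M)"

(* The library determinant exists only for matrices indexed by a whole type. This is its
   definition (the Leibniz formula) for the matrix indexed by the set S; see
   principal_minor_eq_det for the agreement with det. *)
definition principal_minor :: "real^'n^'n \<Rightarrow> 'n set \<Rightarrow> real" where
  "principal_minor M S = (\<Sum>p | p permutes S. of_int (sign p) * (\<Prod>i\<in>S. M $ i $ p i))"

lemma principal_minor_empty: "principal_minor M {} = 1"
  by (simp add: principal_minor_def)

lemma principal_minor_UNIV: "principal_minor M UNIV = det M"
  by (simp add: principal_minor_def det_def)

lemma principal_minor_eq_det:
  fixes M :: "real^'n^'n" and f :: "'m::finite \<Rightarrow> 'n"
  assumes f: "inj f"
  shows "principal_minor M (range f) = det ((\<chi> i j. M $ f i $ f j) :: real^'m^'m)"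
proof -
  have bij: "bij_betw (map_permutation UNIV f) {p. p permutes UNIV} {p. p permutes range f}"
  proof (rule bij_betw_byWitness[where f' = "map_permutation (range f) (inv f)"])
    show "\<forall>p\<in>{p. p permutes UNIV}. map_permutation (range f) (inv f) (map_permutation UNIV f p) = p"
      using f by (auto intro!: map_permutation_compose_inv inj_imp_bij_betw_inv inj_on_imp_bij_betw)
    show "\<forall>p\<in>{p. p permutes range f}. map_permutation UNIV f (map_permutation (range f) (inv f) p) = p"
      using f by (auto intro!: map_permutation_compose_inv inj_imp_bij_betw_inv simp: f_inv_into_f)
    show "map_permutation UNIV f ` {p. p permutes UNIV} \<subseteq> {p. p permutes range f}"
      using f by (auto intro!: map_permutation_permutes inj_on_imp_bij_betw)
    show "map_permutation (range f) (inv f) ` {p. p permutes range f} \<subseteq> {p. p permutes UNIV}"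
      using f by (auto intro!: map_permutation_permutes inj_imp_bij_betw_inv)
  qed
  show ?thesis
    unfolding principal_minor_def det_def
    by (subst sum.reindex_bij_betw[OF bij, symmetric])
      (intro sum.cong refl,
        simp add: f sign_map_permutation prod.reindex map_permutation_apply)
qed

definition marginal_kernel :: "real^'n^'n \<Rightarrow> real^'n^'n" where
  "marginal_kernel L = L ** matrix_inv (L + mat 1)"

(* The conversion to ennreal truncates negative weights; for a positive semidefinite kernel
   all weights are nonnegative. *)
definition L_ensemble :: "real^'n^'n \<Rightarrow> 'n set measure" where
  "L_ensemble L =
     point_measure UNIV (\<lambda>Y. ennreal (principal_minor L Y / det (L + mat 1)))"

definition inclusion_prob :: "real^'n^'n \<Rightarrow> 'n set \<Rightarrow> real" where
  "inclusion_prob L S = measure (L_ensemble L) {Y. S \<subseteq> Y}"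

end

theory Submission
  imports Defs
begin

text \<open>Write \<open>P\<^sub>T\<close> for the coordinate projection onto \<open>T\<close>. Expanding the determinant along rows,
  both the inclusion probability of \<open>S\<close> and the minor of the marginal kernel equal
  \<open>det (L + P\<^sub>T) / det (L + I)\<close> with \<open>T = - S\<close>. Adding a coordinate \<open>j\<close> to \<open>T\<close> multiplies
  \<open>det (L + P\<^sub>T)\<close> by \<open>1 + ((L + P\<^sub>T)\<^sup>-\<^sup>1)\<^sub>j\<^sub>j\<close>, which decreases as \<open>L\<close> increases because matrix inversion is
  antitone in the Loewner order. If \<open>L + P\<^sub>T\<close> is singular, the ratio is zero and there is nothing
  to compare.\<close>

section \<open>Positive semidefinite matrices\<close>

lemma psd_matrix_add: "psd_matrix M \<Longrightarrow> psd_matrix M' \<Longrightarrow> psd_matrix (M + M')"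
  by (auto simp: psd_matrix_def transpose_def vec_eq_iff matrix_vector_mult_add_rdistrib inner_add_right)

lemma psd_matrix_zero: "psd_matrix 0"
  by (auto simp: psd_matrix_def transpose_def vec_eq_iff)

lemma psd_matrix_sum: "(\<And>k. k \<in> F \<Longrightarrow> psd_matrix (f k)) \<Longrightarrow> psd_matrix (sum f F)"
  by (induction F rule: infinite_finite_induct) (auto simp: psd_matrix_zero intro: psd_matrix_add)

lemma psd_matrix_scaleR: "0 \<le> c \<Longrightarrow> psd_matrix M \<Longrightarrow> psd_matrix (c *\<^sub>R M)"
  by (auto simp: psd_matrix_def transpose_scalar scaleR_matrix_vector_assoc[symmetric])

lemma psd_matrix_congruence:
  fixes A :: "real^'n^'p"
  assumes "psd_matrix M"
  shows "psd_matrix (transpose A ** M ** A)"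
proof -
  have "x \<bullet> ((transpose A ** M ** A) *v x) = (A *v x) \<bullet> (M *v (A *v x))" for x
    by (metis dot_lmul_matrix matrix_vector_mul_assoc vector_transpose_matrix)
  then show ?thesis
    using assms by (simp add: psd_matrix_def matrix_transpose_mul matrix_mul_assoc)
qed

lemma psd_matrix_mat_1: "psd_matrix (mat 1)"
  by (simp add: psd_matrix_def)

lemma psd_matrix_observability_gramian: "psd_matrix (observability_gramian N A C)"
proof -
  \<comment> \<open>Each summand is the congruence of the identity by \<open>C ** P\<close>, where
    \<open>P\<close> stands for a power of the system matrix.\<close>
  have "psd_matrix (transpose P ** transpose C ** C ** P)" for P :: "real^'a^'a"
    using psd_matrix_congruence[OF psd_matrix_mat_1, of "C ** P"]
    by (simp add: matrix_transpose_mul matrix_mul_assoc)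
  then show ?thesis
    unfolding observability_gramian_def by (intro psd_matrix_sum)
qed

lemma inner_matrix_vector_symmetric:
  fixes M :: "real^'n^'n"
  assumes "transpose M = M"
  shows "x \<bullet> (M *v y) = (M *v x) \<bullet> y"
  by (metis assms dot_lmul_matrix transpose_matrix_vector)

text \<open>A step from \<open>x\<close> against the gradient direction \<open>M *v x\<close> would
  make the quadratic form negative if that direction were nonzero.\<close>

lemma psd_matrix_kernel:
  assumes psd: "psd_matrix M" and zero: "x \<bullet> (M *v x) = 0"
  shows "M *v x = 0"
proof (rule ccontr)
  define w where "w = M *v x"
  define c where "c = w \<bullet> (M *v w)"
  \<comment> \<open>Short enough that \<open>t * c\<close> \<le> \<open>w \<bullet> w\<close>; the
    \<open>+ 1\<close> avoids division by zero when \<open>c = 0\<close>.\<close>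
  define t where "t = (w \<bullet> w) / (c + 1)"
  assume "M *v x \<noteq> 0"
  then have w: "w \<bullet> w > 0" by (simp add: w_def)
  have c: "c \<ge> 0" using psd by (simp add: c_def psd_matrix_def)
  have t: "t > 0" using w c by (simp add: t_def)
  have "x \<bullet> (M *v w) = w \<bullet> w"
    using psd by (simp add: inner_matrix_vector_symmetric psd_matrix_def w_def)
  then have "(x - t *\<^sub>R w) \<bullet> (M *v (x - t *\<^sub>R w)) = t * (t * c - 2 * (w \<bullet> w))"
    using zero by (simp add: algebra_simps inner_simps matrix_vector_mult_scaleR w_def[symmetric]
        c_def[symmetric])
  then have "0 \<le> t * (t * c - 2 * (w \<bullet> w))"
    using psd unfolding psd_matrix_def by metis
  then have "2 * (w \<bullet> w) \<le> t * c"
    using t by (simp add: zero_le_mult_iff)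
  moreover have "t * c \<le> w \<bullet> w"
    using w c by (simp add: t_def field_simps)
  ultimately show False using w by simp
qed

section \<open>Determinants and inverses under the Loewner order\<close>

lemma det_eq_0_obtain_kernel:
  fixes M :: "real^'n^'n"
  assumes "det M = 0"
  obtains x where "x \<noteq> 0" "M *v x = 0"
  using assms invertible_det_nz[of M] invertible_left_inverse[of M] matrix_left_invertible_ker[of M]
  by blast

lemma kernel_eq_0_of_det_nz:
  fixes M :: "real^'n^'n"
  assumes "det M \<noteq> 0" "M *v x = 0"
  shows "x = 0"
  using assms invertible_det_nz[of M] invertible_left_inverse[of M] matrix_left_invertible_ker[of M]
  by blast

lemma matrix_mult_add_rdistrib: "(A + B) ** (C :: real^'n^'m) = A ** C + B ** C"
  by (simp add: matrix_matrix_mult_def vec_eq_iff distrib_right sum.distrib)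

lemma matrix_mult_matrix_inv:
  fixes M :: "real^'n^'n"
  assumes "det M \<noteq> 0"
  shows "M ** matrix_inv M = mat 1"
  using assms someI_ex[of "\<lambda>M'. M ** M' = mat 1 \<and> M' ** M = mat 1"]
  by (simp add: invertible_det_nz[symmetric] invertible_def matrix_inv_def)

lemma det_add_scaleR_mat_1_nz:
  fixes M :: "real^'n^'n"
  assumes "psd_matrix M" "c > 0"
  shows "det (M + c *\<^sub>R mat 1) \<noteq> 0"
proof
  assume "det (M + c *\<^sub>R mat 1) = 0"
  then obtain x where x: "x \<noteq> 0" "(M + c *\<^sub>R mat 1) *v x = 0"
    by (rule det_eq_0_obtain_kernel)
  have "x \<bullet> (M *v x) + c * (x \<bullet> x) = x \<bullet> ((M + c *\<^sub>R mat 1) *v x)"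
    by (simp add: matrix_vector_mult_add_rdistrib scaleR_matrix_vector_assoc[symmetric] inner_add_right)
  moreover have "x \<bullet> (M *v x) \<ge> 0" "c * (x \<bullet> x) > 0"
    using assms x by (auto simp: psd_matrix_def)
  ultimately show False using x by simp
qed

text \<open>The determinant has no zero on the half-open segment from the identity to \<open>M\<close>.\<close>
lemma det_psd_nonneg:
  fixes M :: "real^'n^'n"
  assumes "psd_matrix M"
  shows "det M \<ge> 0"
proof (rule ccontr)
  define f where "f t = det (t *\<^sub>R M + (1 - t) *\<^sub>R mat 1)" for t :: real
  assume "\<not> det M \<ge> 0"
  then have "f 1 \<le> 0" "f 0 \<ge> 0" by (auto simp: f_def)
  moreover have "continuous_on {0..1} f"
    unfolding f_def det_def by (intro continuous_intros)
  ultimately obtain t where t: "0 \<le> t" "t \<le> 1" "f t = 0"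
    using IVT2'[of f 1 0 0] by auto
  moreover have "t \<noteq> 1" using t \<open>\<not> det M \<ge> 0\<close> by (auto simp: f_def)
  ultimately show False
    using det_add_scaleR_mat_1_nz[of "t *\<^sub>R M" "1 - t"] psd_matrix_scaleR[of t M] assms
    by (simp add: f_def)
qed

lemma det_add_mat_1_pos:
  fixes M :: "real^'n^'n"
  assumes "psd_matrix M"
  shows "det (M + mat 1) > 0"
  using det_add_scaleR_mat_1_nz[OF assms, of 1] det_psd_nonneg[of "M + mat 1"]
    psd_matrix_add[OF assms psd_matrix_mat_1] by simp

text \<open>A kernel vector of \<open>M'\<close> makes the form of \<open>M\<close> vanish, so
  \<open>psd_matrix_kernel\<close> puts it in the kernel of \<open>M\<close>.\<close>

lemma det_nz_loewner_mono:
  fixes M M' :: "real^'n^'n"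
  assumes psd: "psd_matrix M" and le: "M \<preceq>\<^sub>L M'" and nz: "det M \<noteq> 0"
  shows "det M' \<noteq> 0"
proof
  assume "det M' = 0"
  then obtain x where x: "x \<noteq> 0" "M' *v x = 0" by (rule det_eq_0_obtain_kernel)
  have "0 \<le> x \<bullet> ((M' - M) *v x)"
    using le by (simp add: loewner_le_def psd_matrix_def)
  then have "x \<bullet> (M *v x) \<le> 0"
    using x by (simp add: matrix_vector_mult_diff_rdistrib)
  then have "M *v x = 0"
    using psd by (intro psd_matrix_kernel) (auto simp: psd_matrix_def intro: antisym)
  then show False using kernel_eq_0_of_det_nz[OF nz] x by blast
qed

text \<open>The inverse is antitone: expand \<open>0 \<le> (u - v)\<^sup>T M (u - v)\<close> with \<open>u = M\<^sup>-\<^sup>1 e\<close>, \<open>v = M'\<^sup>-\<^sup>1 e\<close>.\<close>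
lemma inner_solution_antimono:
  fixes M M' :: "real^'n^'n"
  assumes psd: "psd_matrix M" and le: "M \<preceq>\<^sub>L M'"
    and u: "M *v u = e" and v: "M' *v v = e"
  shows "e \<bullet> v \<le> e \<bullet> u"
proof -
  have "0 \<le> (u - v) \<bullet> (M *v (u - v))"
    using psd by (simp add: psd_matrix_def)
  also have "\<dots> = e \<bullet> u - 2 * (e \<bullet> v) + v \<bullet> (M *v v)"
    using inner_matrix_vector_symmetric[of M u v] psd u
    by (simp add: psd_matrix_def algebra_simps inner_simps inner_commute)
  finally have "0 \<le> e \<bullet> u - 2 * (e \<bullet> v) + v \<bullet> (M *v v)" .
  moreover have "0 \<le> v \<bullet> ((M' - M) *v v)"
    using le by (simp add: loewner_le_def psd_matrix_def)
  ultimately show ?thesis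
    using v by (simp add: matrix_vector_mult_diff_rdistrib inner_diff_right inner_commute)
qed

section \<open>Coordinate projections and principal minors\<close>

definition coord_proj :: "'n set \<Rightarrow> real^'n^'n" where
  "coord_proj T = (\<chi> i j. if i = j \<and> i \<in> T then 1 else 0)"

lemma coord_proj_mult: "(coord_proj T ** M) $ i $ j = (if i \<in> T then M $ i $ j else 0)"
  by (simp add: coord_proj_def matrix_matrix_mult_def if_distrib if_distribR cong: if_cong)

lemma mult_coord_proj: "(M ** coord_proj T) $ i $ j = (if j \<in> T then M $ i $ j else 0)"
proof -
  have "(M ** coord_proj T) $ i $ j = (\<Sum>k\<in>UNIV. if k = j then (if j \<in> T then M $ i $ j else 0) else 0)"
    unfolding coord_proj_def matrix_matrix_mult_def vec_lambda_beta by (intro sum.cong refl) auto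
  then show ?thesis by simp
qed

lemma transpose_coord_proj: "transpose (coord_proj T) = coord_proj T"
  by (auto simp: coord_proj_def transpose_def vec_eq_iff)

lemma coord_proj_idem: "coord_proj T ** coord_proj T = coord_proj T"
  by (auto simp: vec_eq_iff coord_proj_mult) (auto simp: coord_proj_def)

lemma coord_proj_UNIV: "coord_proj UNIV = mat 1"
  by (auto simp: coord_proj_def mat_def vec_eq_iff)

lemma psd_matrix_coord_proj: "psd_matrix (coord_proj T)"
  using psd_matrix_congruence[OF psd_matrix_mat_1, of "coord_proj T"]
  by (simp add: transpose_coord_proj coord_proj_idem)

text \<open>In the Leibniz sum, a permutation moving an index outside \<open>S\<close> meets a zero
  of an identity row. Entries with row in \<open>S\<close> and column outside are free, so both
  one-sided and two-sided compressions of \<open>M\<close> qualify.\<close>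

lemma det_eq_principal_minor:
  fixes M M' :: "real^'n^'n"
  assumes inside: "\<And>i j. i \<in> S \<Longrightarrow> j \<in> S \<Longrightarrow> M' $ i $ j = M $ i $ j"
    and outside: "\<And>i j. i \<notin> S \<Longrightarrow> M' $ i $ j = (if i = j then 1 else 0)"
  shows "det M' = principal_minor M S"
proof -
  have "det M' = (\<Sum>p | p permutes S. of_int (sign p) * (\<Prod>i\<in>UNIV. M' $ i $ p i))"
    unfolding det_def
  proof (rule sum.mono_neutral_right)
    show "\<forall>p\<in>{p. p permutes UNIV} - {p. p permutes S}. of_int (sign p) * (\<Prod>i\<in>UNIV. M' $ i $ p i) = 0"
    proof
      fix p assume p: "p \<in> {p. p permutes (UNIV :: 'n set)} - {p. p permutes S}"
      then obtain i where "i \<notin> S" "p i \<noteq> i"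
        by (auto simp: permutes_def)
      then have "M' $ i $ p i = 0" by (simp add: outside)
      then have "(\<Prod>i\<in>UNIV. M' $ i $ p i) = 0" by (intro prod_zero) auto
      then show "of_int (sign p) * (\<Prod>i\<in>UNIV. M' $ i $ p i) = 0" by simp
    qed
  qed (auto intro: permutes_subset finite_permutations)
  also have "\<dots> = principal_minor M S"
    unfolding principal_minor_def
  proof (rule sum.cong[OF refl])
    fix p assume "p \<in> {p. p permutes S}"
    then have p: "p permutes S" by simp
    have "(\<Prod>i\<in>UNIV. M' $ i $ p i) = (\<Prod>i\<in>S. M' $ i $ p i)"
      using p by (intro prod.mono_neutral_right) (auto simp: outside permutes_not_in)
    also have "\<dots> = (\<Prod>i\<in>S. M $ i $ p i)"
      using p by (intro prod.cong) (auto simp: inside permutes_in_image)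
    finally show "of_int (sign p) * (\<Prod>i\<in>UNIV. M' $ i $ p i) = of_int (sign p) * (\<Prod>i\<in>S. M $ i $ p i)"
      by simp
  qed
  finally show ?thesis .
qed

lemma principal_minor_eq_det_coord_proj:
  "principal_minor M S = det (coord_proj S ** M + coord_proj (- S))"
  by (rule det_eq_principal_minor[symmetric]) (auto simp: coord_proj_mult, auto simp: coord_proj_def)

lemma principal_minor_nonneg:
  assumes "psd_matrix M"
  shows "principal_minor M S \<ge> 0"
proof -
  \<comment> \<open>Compressing on both sides keeps the matrix symmetric, unlike the row version in
    \<open>principal_minor_eq_det_coord_proj\<close>.\<close>
  have "psd_matrix (coord_proj S ** M ** coord_proj S + coord_proj (- S))"
    using psd_matrix_congruence[OF assms, of "coord_proj S"]
    by (intro psd_matrix_add psd_matrix_coord_proj) (simp add: transpose_coord_proj)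
  moreover have "det (coord_proj S ** M ** coord_proj S + coord_proj (- S)) = principal_minor M S"
    by (rule det_eq_principal_minor)
      (auto simp: coord_proj_mult mult_coord_proj, auto simp: coord_proj_def)
  ultimately show ?thesis using det_psd_nonneg by metis
qed

text \<open>Multilinearity in the rows. \<open>a\<close> is generalized in the induction because
  splitting row \<open>t\<close> replaces it by \<open>b t\<close> in one of the two
  summands.\<close>

lemma det_add_rows_expand:
  fixes a b :: "'n::finite \<Rightarrow> real^'n"
  assumes "finite T"
  shows "det (\<chi> i. if i \<in> T then a i + b i else a i) = (\<Sum>U\<in>Pow T. det (\<chi> i. if i \<in> U then b i else a i))"
  using assms
proof (induction T arbitrary: a rule: finite_induct)
  case empty
  then show ?case by simp
next
  case (insert t T)
  define a' where "a' = a(t := b t)"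
  define c where "c i = (if i \<in> T then a i + b i else a i)" for i
  have "det (\<chi> i. if i \<in> insert t T then a i + b i else a i) = det (\<chi> i. if i = t then a i + b i else c i)"
    by (rule arg_cong[of _ _ det]) (auto simp: vec_eq_iff c_def)
  also have "\<dots> = det (\<chi> i. if i = t then a i else c i) + det (\<chi> i. if i = t then b i else c i)"
    by (rule det_row_add)
  also have "(\<chi> i. if i = t then a i else c i) = (\<chi> i. if i \<in> T then a i + b i else a i)"
    using insert.hyps by (auto simp: vec_eq_iff c_def)
  also have "(\<chi> i. if i = t then b i else c i) = (\<chi> i. if i \<in> T then a' i + b i else a' i)"
    using insert.hyps by (auto simp: vec_eq_iff c_def a'_def)
  \<comment> \<open>The choices made from \<open>a'\<close> are the subsets containing
    \<open>t\<close>; those made from \<open>a\<close> avoid it.\<close>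
  also have "det (\<chi> i. if i \<in> T then a' i + b i else a' i) =
      (\<Sum>U\<in>Pow T. det (\<chi> i. if i \<in> insert t U then b i else a i))"
    unfolding insert.IH by (intro sum.cong refl arg_cong[of _ _ det]) (auto simp: vec_eq_iff a'_def)
  also have "\<dots> = (\<Sum>U\<in>insert t ` Pow T. det (\<chi> i. if i \<in> U then b i else a i))"
    using insert.hyps by (subst sum.reindex) (auto simp: inj_on_def)
  finally show ?case
    using insert by (simp add: Pow_insert sum.union_disjoint) (subst sum.union_disjoint; auto)
qed

text \<open>Each row outside \<open>S\<close> contributes either its row of \<open>M\<close> or a
  unit vector; unit rows on \<open>U\<close> leave the minor on \<open>- U\<close>, which contains
  \<open>S\<close>. The case \<open>S = {}\<close> yields the normalizing constant
  \<open>det (M + mat 1)\<close>.\<close>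

lemma sum_principal_minors_superset:
  "(\<Sum>Y | S \<subseteq> Y. principal_minor M Y) = det (M + coord_proj (- S))"
proof -
  have "det (M + coord_proj (- S)) = det (\<chi> i. if i \<in> - S then M $ i + axis i 1 else M $ i)"
    by (rule arg_cong[of _ _ det]) (auto simp: vec_eq_iff coord_proj_def axis_def)
  also have "\<dots> = (\<Sum>U\<in>Pow (- S). det (\<chi> i. if i \<in> U then axis i 1 else M $ i))"
    by (rule det_add_rows_expand) simp
  also have "\<dots> = (\<Sum>U\<in>Pow (- S). principal_minor M (- U))"
    by (intro sum.cong refl det_eq_principal_minor) (auto simp: axis_def)
  also have "\<dots> = (\<Sum>Y | S \<subseteq> Y. principal_minor M Y)"
    by (rule sum.reindex_bij_witness[of _ uminus uminus]) auto
  finally show ?thesis by simp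
qed

section \<open>Inclusion probabilities\<close>

lemma inclusion_prob_eq_det:
  assumes "psd_matrix L"
  shows "inclusion_prob L S = det (L + coord_proj (- S)) / det (L + mat 1)"
proof -
  \<comment> \<open>Makes the conversion of the weights to \<open>ennreal\<close> lossless.\<close>
  have nonneg: "principal_minor L Y / det (L + mat 1) \<ge> 0" for Y
    using principal_minor_nonneg[OF assms] det_add_mat_1_pos[OF assms] by (simp add: less_imp_le)
  have "emeasure (L_ensemble L) {Y. S \<subseteq> Y} =
      ennreal (\<Sum>Y | S \<subseteq> Y. principal_minor L Y / det (L + mat 1))"
    unfolding L_ensemble_def
    by (subst emeasure_point_measure_finite) (auto simp: nonneg sum_ennreal)
  then have "inclusion_prob L S = (\<Sum>Y | S \<subseteq> Y. principal_minor L Y / det (L + mat 1))"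
    by (simp add: inclusion_prob_def measure_def sum_nonneg nonneg)
  also have "\<dots> = det (L + coord_proj (- S)) / det (L + mat 1)"
    by (simp add: sum_divide_distrib[symmetric] sum_principal_minors_superset)
  finally show ?thesis .
qed

lemma principal_minor_marginal_kernel:
  assumes "det (L + mat 1) \<noteq> 0"
  shows "principal_minor (marginal_kernel L) S = det (L + coord_proj (- S)) / det (L + mat 1)"
proof -
  let ?R = "matrix_inv (L + mat 1)"
  have inv: "(L + mat 1) ** ?R = mat 1"
    using matrix_mult_matrix_inv[OF assms] .
  \<comment> \<open>Factoring \<open>?R\<close> out on the right turns the row form of the minor of
    the marginal kernel into a product.\<close>
  have "coord_proj S ** L + coord_proj (- S) ** (L + mat 1) = L + coord_proj (- S)"
    by (auto simp: vec_eq_iff coord_proj_mult) (auto simp: coord_proj_def mat_def)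
  then have "(L + coord_proj (- S)) ** ?R = coord_proj S ** marginal_kernel L + coord_proj (- S)"
    by (metis inv marginal_kernel_def matrix_mult_add_rdistrib matrix_mul_assoc matrix_mul_rid)
  then have "principal_minor (marginal_kernel L) S = det (L + coord_proj (- S)) * det ?R"
    by (metis principal_minor_eq_det_coord_proj det_mul)
  moreover have "det (L + mat 1) * det ?R = 1"
    by (metis inv det_mul det_I)
  ultimately show ?thesis using assms by (simp add: field_simps)
qed

section \<open>Monotonicity of determinant ratios\<close>

lemma det_add_coord_proj_insert:
  fixes L :: "real^'n^'n"
  assumes j: "j \<notin> T" and u: "(L + coord_proj T) *v u = axis j 1"
  shows "det (L + coord_proj (insert j T)) = det (L + coord_proj T) * (1 + u $ j)"
proof -
  let ?M = "L + coord_proj T"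
  let ?P = "\<lambda>x. \<chi> i k. if k = j then (?M *v x) $ i else ?M $ i $ k"
  \<comment> \<open>Only column \<open>j\<close> changes, by a unit vector, so it becomes the image
    of \<open>axis j 1 + u\<close>; Cramer's rule then yields the factor
    \<open>1 + u $ j\<close>.\<close>
  have "L + coord_proj (insert j T) = ?P (axis j 1 + u)"
  proof -
    have "?M *v axis j 1 = column j ?M" by (simp add: matrix_vector_mult_basis)
    then have "(?M *v (axis j 1 + u)) $ i = ?M $ i $ j + axis j 1 $ i" for i
      by (simp add: matrix_vector_right_distrib u column_def)
    then show ?thesis
      using j by (auto simp: vec_eq_iff coord_proj_def axis_def)
  qed
  then show ?thesis using cramer_lemma[of j ?M "axis j 1 + u"] by simp
qed

lemma solution_exists_of_det_nz:
  fixes M :: "real^'n^'n"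
  assumes "det M \<noteq> 0"
  obtains u where "M *v u = e"
proof
  show "M *v (matrix_inv M *v e) = e"
    using assms by (simp add: matrix_vector_mul_assoc matrix_mult_matrix_inv)
qed

lemma det_ratio_insert_mono:
  fixes L L' :: "real^'n^'n"
  assumes psd: "psd_matrix L" "psd_matrix L'" and le: "L \<preceq>\<^sub>L L'"
    and nz: "det (L + coord_proj T) \<noteq> 0" and j: "j \<notin> T"
  shows "det (L + coord_proj T) / det (L + coord_proj (insert j T))
    \<le> det (L' + coord_proj T) / det (L' + coord_proj (insert j T))"
proof -
  have psd_T: "psd_matrix (L + coord_proj T)" "psd_matrix (L' + coord_proj T)"
    using psd by (auto intro: psd_matrix_add psd_matrix_coord_proj)
  have le_T: "L + coord_proj T \<preceq>\<^sub>L L' + coord_proj T"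
    using le by (simp add: loewner_le_def)
  have nz': "det (L' + coord_proj T) \<noteq> 0"
    using det_nz_loewner_mono[OF psd_T(1) le_T nz] .
  obtain u where u: "(L + coord_proj T) *v u = axis j 1"
    using solution_exists_of_det_nz[OF nz] .
  obtain v where v: "(L' + coord_proj T) *v v = axis j 1"
    using solution_exists_of_det_nz[OF nz'] .
  have "v $ j \<le> u $ j"
    using inner_solution_antimono[OF psd_T(1) le_T u v] by (simp add: inner_axis')
  \<comment> \<open>This form equals \<open>v $ j\<close>, so the denominator of
    \<open>1 / (1 + v $ j)\<close> is positive and the fractions can be compared.\<close>
  moreover have "0 \<le> v \<bullet> ((L' + coord_proj T) *v v)"
    using psd_T(2) by (simp add: psd_matrix_def)
  then have "0 \<le> v $ j" by (simp add: v inner_axis)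
  ultimately show ?thesis
    using nz nz' by (simp add: det_add_coord_proj_insert[OF j u] det_add_coord_proj_insert[OF j v] frac_le)
qed

text \<open>The ratio telescopes into factors that enlarge \<open>T\<close> by one coordinate each.\<close>
lemma det_ratio_mono:
  fixes L L' :: "real^'n^'n"
  assumes psd: "psd_matrix L" "psd_matrix L'" and le: "L \<preceq>\<^sub>L L'"
  shows "det (L + coord_proj T) / det (L + mat 1) \<le> det (L' + coord_proj T) / det (L' + mat 1)"
proof (cases "det (L + coord_proj T) = 0")
  case True
  have "0 \<le> det (L' + coord_proj T)"
    using psd by (intro det_psd_nonneg psd_matrix_add psd_matrix_coord_proj)
  then show ?thesis
    using True det_add_mat_1_pos[OF psd(2)] by simp
next
  case nz: False
  define g where "g U = det (L + coord_proj U)" for U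
  define g' where "g' U = det (L' + coord_proj U)" for U
  \<comment> \<open>Nonsingularity passes upward in the Loewner order, first from \<open>T\<close>
    to \<open>T \<union> R\<close>, then from \<open>L\<close> to \<open>L'\<close>.\<close>
  have pos: "g (T \<union> R) > 0" "g' (T \<union> R) > 0" for R
  proof -
    have psd_R: "psd_matrix (L + coord_proj (T \<union> R))" "psd_matrix (L' + coord_proj (T \<union> R))"
      using psd by (auto intro: psd_matrix_add psd_matrix_coord_proj)
    have "coord_proj (T \<union> R) - coord_proj T = (coord_proj (R - T) :: real^'n^'n)"
      by (auto simp: coord_proj_def vec_eq_iff)
    then have "L + coord_proj T \<preceq>\<^sub>L L + coord_proj (T \<union> R)"
      by (simp add: loewner_le_def psd_matrix_coord_proj)
    then have nz_R: "g (T \<union> R) \<noteq> 0"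
      unfolding g_def using nz psd(1)
      by (meson det_nz_loewner_mono psd_matrix_add psd_matrix_coord_proj)
    moreover have "g' (T \<union> R) \<noteq> 0"
      using det_nz_loewner_mono[OF psd_R(1), of "L' + coord_proj (T \<union> R)"] nz_R le
      by (simp add: g_def g'_def loewner_le_def)
    ultimately show "g (T \<union> R) > 0" "g' (T \<union> R) > 0"
      using psd_R[THEN det_psd_nonneg] by (auto simp: g_def g'_def)
  qed
  \<comment> \<open>At \<open>R = UNIV\<close> the projection becomes the identity, giving the
    claim.\<close>
  have "g T / g (T \<union> R) \<le> g' T / g' (T \<union> R)" for R
    using finite[of R]
  proof (induction R rule: finite_induct)
    case empty
    then show ?case using pos[of "{}"] by simp
  next
    case (insert j R)
    show ?case
    proof (cases "j \<in> T")
      case True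
      then show ?thesis using insert.IH by (simp add: insert_absorb)
    next
      case False
      have step: "g (T \<union> R) / g (T \<union> insert j R) \<le> g' (T \<union> R) / g' (T \<union> insert j R)"
        using det_ratio_insert_mono[OF psd le, of "T \<union> R" j] pos(1)[of R] False insert.hyps
        by (simp add: g_def g'_def)
      have "g T / g (T \<union> insert j R) = g T / g (T \<union> R) * (g (T \<union> R) / g (T \<union> insert j R))"
        using pos(1)[of R] by simp
      also have "\<dots> \<le> g' T / g' (T \<union> R) * (g' (T \<union> R) / g' (T \<union> insert j R))"
        using insert.IH step pos[of R] pos[of "insert j R"] pos[of "{}"]
        by (intro mult_mono) (auto simp: less_imp_le)
      also have "\<dots> = g' T / g' (T \<union> insert j R)"
        using pos(2)[of R] by simp
      finally show ?thesis .
    qed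
  qed
  from this[of UNIV] show ?thesis
    by (simp add: g_def g'_def coord_proj_UNIV)
qed

text \<open>The equalities tie the measure-theoretic probabilities to the marginal kernels; the
  inequality is \<open>det_ratio_mono\<close> at \<open>T = - S\<close>.\<close>

theorem corollary2:
  fixes A1 A2 L1 L2 :: "real^'n^'n"
    and C1 :: "real^'n^'p" and C2 :: "real^'n^'q"
    and N :: nat
  assumes "L1 = observability_gramian N A1 C1"
    and "L2 = observability_gramian N A2 C2"
    and "L1 \<preceq>\<^sub>L L2"
  shows "\<forall>S. inclusion_prob L1 S = principal_minor (marginal_kernel L1) S
           \<and> inclusion_prob L2 S = principal_minor (marginal_kernel L2) S
           \<and> inclusion_prob L1 S \<le> inclusion_prob L2 S"
proof -
  have psd: "psd_matrix L1" "psd_matrix L2"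
    using assms(1,2) psd_matrix_observability_gramian by auto
  have "inclusion_prob L S = principal_minor (marginal_kernel L) S" if "psd_matrix L"
    for L :: "real^'n^'n" and S
    using det_add_mat_1_pos[OF that] by (simp add: inclusion_prob_eq_det[OF that] principal_minor_marginal_kernel)
  moreover have "inclusion_prob L1 S \<le> inclusion_prob L2 S" for S
    unfolding inclusion_prob_eq_det[OF psd(1)] inclusion_prob_eq_det[OF psd(2)]
    by (rule det_ratio_mono[OF psd assms(3)])
  ultimately show ?thesis using psd by blast
qed

end
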